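(* For the square game on the square grid with $n$ winning sets, $\mathrm{SC}(\mathcal G_{\square},3)\ge \frac{2n}{15}-o(n)$.
   Context: An $s$-of-$k$ game on a $k$-uniform hypergraph $(V,\mathcal F)$ (winning sets are $k$-element subsets of the finite set $V$), $1\le s\le k$: Maker and Breaker alternately claim unclaimed vertices, Maker first, until all are claimed; the score is the number of winning sets in which Maker claimed at least $s$ vertices (Maker maximizes, Breaker minimizes). $\mathrm{SC}(\mathcal H,s)$ is the score under optimal play of both players. $\mathcal G_{\square}$ is the hypergraph whose vertices are the points of a finite portion of the square lattice and whose winning sets are the sets of four corners of the unit square faces, so $k=4$. Grids are assumed "two-dimensional": the number of winning sets within constant distance of the boundary is $o(n)$, where $n$ is the number of winning sets; $o(n)$ refers to $n\to\infty$. *)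

theory Defs
  imports "HOL-Analysis.Analysis" "HOL-Library.Landau_Symbols"
begin

type_synonym 'a hypergraph = "'a set \<times> 'a set set"

definition uniform_hypergraph :: "nat \<Rightarrow> 'a hypergraph \<Rightarrow> bool" where
  "uniform_hypergraph k H \<longleftrightarrow>
     finite (fst H) \<and> (\<forall>A \<in> snd H. A \<subseteq> fst H \<and> card A = k)"

datatype player = Maker | Breaker

definition score :: "'a set set \<Rightarrow> nat \<Rightarrow> 'a set \<Rightarrow> nat" where
  "score F s M = card {A \<in> F. s \<le> card (A \<inter> M)}"

(* game_value F s p U M is the final score under optimal play from the position in which p is to
   move, U is the set of unclaimed vertices and M the set of vertices claimed by Maker so far.
   The finiteness guard only makes the recursion total; games are played on finite vertex sets. *)
function game_value ::
    "'a set set \<Rightarrow> nat \<Rightarrow> player \<Rightarrow> 'a set \<Rightarrow> 'a set \<Rightarrow> nat" where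
  "game_value F s p U M =
     (if finite U \<and> U \<noteq> {} then
        (case p of
           Maker \<Rightarrow> Max ((\<lambda>v. game_value F s Breaker (U - {v}) (insert v M)) ` U)
         | Breaker \<Rightarrow> Min ((\<lambda>v. game_value F s Maker (U - {v}) M) ` U))
      else score F s M)"
  by pat_completeness auto
termination
  by (relation "Wellfounded.measure (\<lambda>(F, s, p, U, M). card U)")
     (auto intro: card_Diff1_less simp: card_gt_0_iff)

declare game_value.simps [simp del]

definition SC :: "'a hypergraph \<Rightarrow> nat \<Rightarrow> nat" where
  "SC H s = game_value (snd H) s Maker (fst H) {}"

definition unit_square :: "int \<times> int \<Rightarrow> (int \<times> int) set" where
  "unit_square = (\<lambda>(x, y). {(x, y), (x + 1, y), (x, y + 1), (x + 1, y + 1)})"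

definition faces :: "(int \<times> int) set \<Rightarrow> (int \<times> int) set set" where
  "faces V = {A \<in> range unit_square. A \<subseteq> V}"

definition square_grid :: "(int \<times> int) set \<Rightarrow> (int \<times> int) hypergraph" where
  "square_grid V = (V, faces V)"

lemma finite_faces: "finite V \<Longrightarrow> finite (faces V)"
  unfolding faces_def by (rule finite_subset[of _ "Pow V"]) auto

lemma uniform_square_grid: "finite V \<Longrightarrow> uniform_hypergraph 4 (square_grid V)"
  by (auto simp: uniform_hypergraph_def square_grid_def faces_def unit_square_def)

(* A point of V is interior if all four unit squares around it are faces. *)
definition grid_boundary :: "(int \<times> int) set \<Rightarrow> (int \<times> int) set" where
  "grid_boundary V = {p \<in> V. \<exists>c. p \<in> unit_square c \<and> \<not> unit_square c \<subseteq> V}"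

definition lattice_dist :: "int \<times> int \<Rightarrow> int \<times> int \<Rightarrow> real" where
  "lattice_dist p q =
     dist (real_of_int (fst p), real_of_int (snd p)) (real_of_int (fst q), real_of_int (snd q))"

definition faces_near_boundary :: "real \<Rightarrow> (int \<times> int) set \<Rightarrow> (int \<times> int) set set" where
  "faces_near_boundary d V =
     {A \<in> faces V. \<exists>p \<in> A. \<exists>q \<in> grid_boundary V. lattice_dist p q \<le> d}"

(* Being o(n) is a property of a family of grids: for each constant d, the number of faces within
   distance d of the boundary is bounded over the whole family by one function of the number n of
   faces, and this function is o(n). *)
definition two_dimensional :: "(int \<times> int) set set \<Rightarrow> bool" where
  "two_dimensional \<C> \<longleftrightarrow>
     (\<forall>d. \<exists>g. g \<in> o(\<lambda>n. real n) \<and>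
        (\<forall>V \<in> \<C>. real (card (faces_near_boundary d V)) \<le> g (card (faces V))))"

end

(* The lattice is tiled by blocks of 3 x 5 points. On a single block Maker, even when Breaker moves
   first and Maker only ever answers inside the block, can secure two of its eight faces. Disjoint
   blocks are played independently, so Maker secures twice the number of blocks contained in V.
   A block that meets V but is not contained in V contains a boundary point, hence all but o(n) of
   the n faces have their lower corner in a block contained in V, and a block has only 15 points to be such corners. *)
theory Submission
  imports Defs
begin

section \<open>A calculus of strategies for Maker as second player, closed under disjoint
  sums\<close>

section \<open>Goals that Maker secures as second player\<close>

(* Maker owns M and can, by answering Breaker's moves in S inside S, reach a set satisfying Q.
   Shrinking the carrier to an arbitrary T means that the rest of S is ignored from then on. *)
inductive secures :: "('a set \<Rightarrow> bool) \<Rightarrow> 'a set \<Rightarrow> 'a set \<Rightarrow> bool" for Q where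
  won: "Q M \<Longrightarrow> secures Q S M"
| reply: "S \<noteq> {} \<Longrightarrow>
    (\<And>v. v \<in> S \<Longrightarrow> \<exists>w T. w \<in> S \<and> w \<noteq> v \<and> T \<subseteq> S - {v, w} \<and> secures Q T (insert w M)) \<Longrightarrow>
    secures Q S M"

text \<open>If \<open>v\<close> lies outside \<open>S\<close>, Maker acts as if Breaker had taken an
  arbitrary point of \<open>S\<close>; the answer then avoids \<open>v\<close> automatically. So
  Breaker may play anywhere.\<close>

lemma secures_cases_reply:
  assumes "secures Q S M" "\<not> Q M"
  shows "\<exists>w T. w \<in> S \<and> w \<noteq> v \<and> T \<subseteq> S - {v, w} \<and> secures Q T (insert w M)"
  using assms(1)
proof cases
  case won
  with assms(2) show ?thesis by simp
next
  case reply
  then obtain u where "u \<in> S" by blast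
  show ?thesis
  proof (cases "v \<in> S")
    case True
    then show ?thesis using reply(2) by blast
  next
    case False
    from reply(2)[OF \<open>u \<in> S\<close>] obtain w T
      where "w \<in> S" "T \<subseteq> S - {u, w}" "secures Q T (insert w M)" by blast
    with False show ?thesis by blast
  qed
qed

lemma secures_superset:
  assumes "secures Q S M" "S \<subseteq> S'"
  shows "secures Q S' M"
proof (cases "Q M")
  case True
  then show ?thesis by (rule won)
next
  case False
  note r = secures_cases_reply[OF assms(1) False]
  show ?thesis
  proof (rule reply)
    show "S' \<noteq> {}" using r assms(2) by blast
    show "\<exists>w T. w \<in> S' \<and> w \<noteq> v \<and> T \<subseteq> S' - {v, w} \<and> secures Q T (insert w M)" for v
      using r[of v] assms(2) by blast
  qed
qed

text \<open>The same answers work while Maker also owns \<open>N\<close>. In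
  \<open>secures_conj\<close> this takes up the points gained in a component that is already
  won.\<close>

lemma secures_imp:
  assumes "secures Q S M" "\<And>X. Q X \<Longrightarrow> Q' (X \<union> N)"
  shows "secures Q' S (M \<union> N)"
  using assms(1)
proof induction
  case (won M S)
  then show ?case by (intro secures.won assms(2))
next
  case (reply S M)
  show ?case
  proof (rule secures.reply[OF reply(1)])
    fix v assume "v \<in> S"
    then show "\<exists>w T. w \<in> S \<and> w \<noteq> v \<and> T \<subseteq> S - {v, w} \<and> secures Q' T (insert w (M \<union> N))"
      using reply(2)[of v] by auto
  qed
qed

lemma secures_conj:
  assumes "secures Q\<^sub>1 S\<^sub>1 M\<^sub>1" "secures Q\<^sub>2 S\<^sub>2 M\<^sub>2" "S\<^sub>1 \<inter> S\<^sub>2 = {}" "mono Q\<^sub>1" "mono Q\<^sub>2"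
  shows "secures (\<lambda>X. Q\<^sub>1 X \<and> Q\<^sub>2 X) (S\<^sub>1 \<union> S\<^sub>2) (M\<^sub>1 \<union> M\<^sub>2)"
proof -
  let ?Q = "\<lambda>X. Q\<^sub>1 X \<and> Q\<^sub>2 X"
  have up1: "Q\<^sub>1 Y" if "Q\<^sub>1 X" "X \<subseteq> Y" for X Y using monoD[OF assms(4) that(2)] that(1) by simp
  have up2: "Q\<^sub>2 Y" if "Q\<^sub>2 X" "X \<subseteq> Y" for X Y using monoD[OF assms(5) that(2)] that(1) by simp
  show ?thesis using assms(1-3)
  proof (induction arbitrary: S\<^sub>2 M\<^sub>2)
    case (won M\<^sub>1 S\<^sub>1)
    have "secures ?Q S\<^sub>2 (M\<^sub>2 \<union> M\<^sub>1)"
      by (rule secures_imp[OF won(2)]) (use up1[OF won(1)] up2 in auto)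
    then show ?case by (metis secures_superset sup_commute sup_ge2)
  next
    case (reply S\<^sub>1 M\<^sub>1)
    note outer = reply
    \<comment> \<open>If the second goal is reached first, the first game goes on alone from this
      position, which the outer induction hypothesis does not cover.\<close>
    have first: "secures Q\<^sub>1 S\<^sub>1 M\<^sub>1"
      using outer(1,2) by (intro secures.reply) blast+
    from outer(3,4) show ?case
    proof (induction)
      case (won M\<^sub>2 S\<^sub>2)
      have "secures ?Q S\<^sub>1 (M\<^sub>1 \<union> M\<^sub>2)"
        by (rule secures_imp[OF first]) (use up2[OF won(1)] up1 in auto)
      then show ?case by (rule secures_superset) simp
    next
      case (reply S\<^sub>2 M\<^sub>2)
      have second: "secures Q\<^sub>2 S\<^sub>2 M\<^sub>2"
        using reply(1,2) by (intro secures.reply) blast+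
      show ?case
      proof (rule secures.reply)
        show "S\<^sub>1 \<union> S\<^sub>2 \<noteq> {}" using reply(1) by simp
        fix v assume "v \<in> S\<^sub>1 \<union> S\<^sub>2"
        then show "\<exists>w T. w \<in> S\<^sub>1 \<union> S\<^sub>2 \<and> w \<noteq> v \<and> T \<subseteq> S\<^sub>1 \<union> S\<^sub>2 - {v, w} \<and>
          secures ?Q T (insert w (M\<^sub>1 \<union> M\<^sub>2))"
        proof
          assume v: "v \<in> S\<^sub>1"
          from outer(2)[OF v] obtain w T where w: "w \<in> S\<^sub>1" "w \<noteq> v" "T \<subseteq> S\<^sub>1 - {v, w}"
            and IH: "\<And>S\<^sub>2 M\<^sub>2. secures Q\<^sub>2 S\<^sub>2 M\<^sub>2 \<Longrightarrow> T \<inter> S\<^sub>2 = {} \<Longrightarrow>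
              secures ?Q (T \<union> S\<^sub>2) (insert w M\<^sub>1 \<union> M\<^sub>2)" by blast
          have "secures ?Q (T \<union> S\<^sub>2) (insert w (M\<^sub>1 \<union> M\<^sub>2))"
            using IH[OF second] w reply(3) by auto
          moreover have "T \<union> S\<^sub>2 \<subseteq> S\<^sub>1 \<union> S\<^sub>2 - {v, w}" using w v reply(3) by auto
          ultimately show ?thesis using w by blast
        next
          assume v: "v \<in> S\<^sub>2"
          from reply(2)[OF v] obtain w T where w: "w \<in> S\<^sub>2" "w \<noteq> v" "T \<subseteq> S\<^sub>2 - {v, w}"
            and IH: "S\<^sub>1 \<inter> T = {} \<Longrightarrow> secures ?Q (S\<^sub>1 \<union> T) (M\<^sub>1 \<union> insert w M\<^sub>2)" by blast
          have "secures ?Q (S\<^sub>1 \<union> T) (insert w (M\<^sub>1 \<union> M\<^sub>2))"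
            using IH w reply(3) by auto
          moreover have "S\<^sub>1 \<union> T \<subseteq> S\<^sub>1 \<union> S\<^sub>2 - {v, w}" using w v reply(3) by auto
          ultimately show ?thesis using w by blast
        qed
      qed
    qed
  qed
qed

lemma secures_UN:
  assumes "finite I" "disjoint_family_on S I"
    and "\<And>i. i \<in> I \<Longrightarrow> secures (Q i) (S i) {}" "\<And>i. mono (Q i)"
  shows "secures (\<lambda>X. \<forall>i\<in>I. Q i X) (\<Union>i\<in>I. S i) {}"
  using assms(1-3)
proof (induction I rule: finite_induct)
  case empty
  then show ?case by (simp add: secures.won)
next
  case (insert i I)
  have "secures (\<lambda>X. Q i X \<and> (\<forall>j\<in>I. Q j X)) (S i \<union> (\<Union>j\<in>I. S j)) ({} \<union> {})"
  proof (rule secures_conj)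
    show "secures (Q i) (S i) {}" using insert.prems by simp
    show "secures (\<lambda>X. \<forall>j\<in>I. Q j X) (\<Union>j\<in>I. S j) {}"
      using insert.prems by (intro insert.IH) (auto simp: disjoint_family_on_def)
    show "S i \<inter> (\<Union>j\<in>I. S j) = {}"
      using insert.prems(1) insert.hyps(2) by (auto simp: disjoint_family_on_def)
    show "mono (\<lambda>X. \<forall>j\<in>I. Q j X)"
      using assms(4) by (fastforce simp: mono_def)
  qed (rule assms(4))
  then show ?case by simp
qed

lemma secures_image:
  assumes "secures Q S M" "inj_on f S" "\<And>X. Q X \<Longrightarrow> Q' (f ` X)"
  shows "secures Q' (f ` S) (f ` M)"
  using assms(1,2)
proof induction
  case (won M S)
  then show ?case by (intro secures.won assms(3))
next
  case (reply S M)
  show ?case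
  proof (rule secures.reply)
    show "f ` S \<noteq> {}" using reply(1) by simp
    fix y assume "y \<in> f ` S"
    then obtain v where v: "v \<in> S" "y = f v" by blast
    from reply(2)[OF v(1)] obtain w T where w: "w \<in> S" "w \<noteq> v" "T \<subseteq> S - {v, w}"
      and IH: "inj_on f T \<Longrightarrow> secures Q' (f ` T) (f ` insert w M)" by blast
    have "inj_on f T" using w(3) reply(3) by (meson Diff_subset inj_on_subset order_trans)
    then have "secures Q' (f ` T) (insert (f w) (f ` M))" using IH by simp
    moreover have "f ` T \<subseteq> f ` S - {y, f w}"
      using w v reply(3) by (auto simp: inj_on_def)
    moreover have "f w \<noteq> y" using w v reply(3) by (auto simp: inj_on_def)
    ultimately show "\<exists>w T. w \<in> f ` S \<and> w \<noteq> y \<and> T \<subseteq> f ` S - {y, w} \<and>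
        secures Q' T (insert w (f ` M))" using w(1) by blast
  qed
qed

text \<open>Along any line of play Maker only gains points of \<open>S\<close>, so by monotonicity
  owning all of \<open>S\<close> is enough. This settles the end of the game, when the remaining
  carrier is entirely Maker's.\<close>

lemma secures_final:
  assumes "secures Q S M" "mono Q"
  shows "Q (S \<union> M)"
  using assms(1)
proof induction
  case (won M S)
  then show ?case using monoD[OF assms(2), of M "S \<union> M"] by auto
next
  case (reply S M)
  then obtain v where "v \<in> S" by blast
  from reply(2)[OF this] obtain w T where w: "w \<in> S" "T \<subseteq> S" "Q (T \<union> insert w M)" by blast
  then have "T \<union> insert w M \<subseteq> S \<union> M" by blast
  then show ?case using w(3) monoD[OF assms(2), of "T \<union> insert w M" "S \<union> M"] by simp
qed

section \<open>Playing a secured goal inside the real game on the whole vertex set\<close>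

section \<open>From secured goals to the game value\<close>

lemma mono_score:
  assumes "finite F" "\<And>A. A \<in> F \<Longrightarrow> finite A"
  shows "mono (\<lambda>X. k \<le> score F s X)"
proof (rule monoI, rule le_boolI)
  fix X Y :: "'a set" assume "X \<subseteq> Y" "k \<le> score F s X"
  have "score F s X \<le> score F s Y"
    unfolding score_def
  proof (rule card_mono)
    show "{A \<in> F. s \<le> card (A \<inter> X)} \<subseteq> {A \<in> F. s \<le> card (A \<inter> Y)}"
      using \<open>X \<subseteq> Y\<close> assms(2) by (auto elim!: order_trans intro!: card_mono)
  qed (use assms(1) in simp)
  then show "k \<le> score F s Y" using \<open>k \<le> score F s X\<close> by simp
qed

lemma game_value_Maker_ge:
  assumes "finite U" "v \<in> U"
  shows "game_value F s Breaker (U - {v}) (insert v M) \<le> game_value F s Maker U M"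
proof -
  have "game_value F s Maker U M =
      Max ((\<lambda>v. game_value F s Breaker (U - {v}) (insert v M)) ` U)"
    using assms by (subst game_value.simps) auto
  then show ?thesis using assms by simp
qed

lemma game_value_Breaker_geI:
  assumes "finite U" "U \<noteq> {}" "\<And>v. v \<in> U \<Longrightarrow> k \<le> game_value F s Maker (U - {v}) M"
  shows "k \<le> game_value F s Breaker U M"
proof -
  have "game_value F s Breaker U M = Min ((\<lambda>v. game_value F s Maker (U - {v}) M) ` U)"
    using assms by (subst game_value.simps) auto
  then show ?thesis using assms by simp
qed

lemma game_value_over: "game_value F s p {} M = score F s M"
  by (subst game_value.simps) simp

(* The carrier S may contain points that Maker has already claimed for real: they come from the
   free moves Maker has to make whenever the prescribed answer is already his. *)
lemma secures_game_value:
  assumes F: "finite F" "\<And>A. A \<in> F \<Longrightarrow> finite A"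
    and "finite U" "secures (\<lambda>X. k \<le> score F s X) S M" "S \<subseteq> U \<union> X" "M \<subseteq> X"
  shows "k \<le> game_value F s Breaker U X" "k \<le> game_value F s Maker U X"
  using assms(3-)
proof (induction "card U" arbitrary: U S M X rule: less_induct)
  let ?Q = "\<lambda>X. k \<le> score F s X"
  have mono: "mono ?Q" using F by (rule mono_score)
  have up: "?Q Y" if "?Q X" "X \<subseteq> Y" for X Y
    using monoD[OF mono, OF that(2)] that(1) by simp
  have final: "?Q X" if "secures ?Q S M" "S \<subseteq> X" "M \<subseteq> X" for S M X
    by (rule up[OF secures_final[OF that(1) mono]]) (use that(2,3) in simp)
  case less
  note IH = less
  {
    case 1
    note prems = 1
    show ?case
    proof (cases "U = {}")
      case True
      then show ?thesis using final[OF prems(2)] prems(3,4) by (simp add: game_value_over)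
    next
      case False
      show ?thesis
      proof (rule game_value_Breaker_geI[OF prems(1) False])
        fix v assume v: "v \<in> U"
        then have smaller: "card (U - {v}) < card U"
          using prems(1) by (intro card_Diff1_less)
        show "k \<le> game_value F s Maker (U - {v}) X"
        \<comment> \<open>Once the goal is reached the carrier is replaced by the empty set:
          \<open>S\<close> might contain \<open>v\<close>, which is lost to Breaker.\<close>
        proof (cases "?Q M")
          case True
          then show ?thesis
            using IH(2)[OF smaller, of "{}" M X] prems(1,4) by (auto intro: secures.won)
        next
          case False
          from secures_cases_reply[OF prems(2) False, of v] obtain w T
            where w: "w \<in> S" "w \<noteq> v" "T \<subseteq> S - {v, w}" "secures ?Q T (insert w M)" by blast
          show ?thesis
          proof (cases "w \<in> X")
            \<comment> \<open>The prescribed answer is already Maker's, so Maker is still to move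
              and the second claim applies to the smaller board.\<close>
            case True
            then show ?thesis
              using IH(2)[OF smaller _ w(4), of X] prems(1,3,4) w(3) by auto
          next
            case False
            then have wU: "w \<in> U - {v}" using w prems(3) by auto
            have "card (U - {v} - {w}) < card U"
              using smaller wU prems(1) by (metis card_Diff1_le le_less_trans)
            from IH(1)[OF this _ w(4), of "insert w X"]
            have "k \<le> game_value F s Breaker (U - {v} - {w}) (insert w X)"
              using prems(1,3,4) w(3) by auto
            also have "\<dots> \<le> game_value F s Maker (U - {v}) X"
              using prems(1) wU by (intro game_value_Maker_ge) auto
            finally show ?thesis .
          qed
        qed
      qed
    qed
  next
    case 2
    note prems = 2
    show ?case
    proof (cases "U = {}")
      case True
      then show ?thesis using final[OF prems(2)] prems(3,4) by (simp add: game_value_over)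
    next
      case False
      then obtain u where u: "u \<in> U" by blast
      then have "card (U - {u}) < card U" using prems(1) by (intro card_Diff1_less)
      from IH(1)[OF this _ prems(2), of "insert u X"]
      have "k \<le> game_value F s Breaker (U - {u}) (insert u X)" using prems(1,3,4) by auto
      also have "\<dots> \<le> game_value F s Maker U X"
        by (rule game_value_Maker_ge[OF prems(1) u])
      finally show ?thesis .
    qed
  }
qed

text \<open>Moving first does no harm: the opening move is a free one, after which Maker plays as
  second player.\<close>

corollary secures_SC:
  assumes "uniform_hypergraph r H" "secures (\<lambda>X. k \<le> score (snd H) s X) S {}" "S \<subseteq> fst H"
  shows "k \<le> SC H s"
proof -
  have V: "finite (fst H)" and A: "\<And>A. A \<in> snd H \<Longrightarrow> A \<subseteq> fst H"
    using assms(1) by (auto simp: uniform_hypergraph_def)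
  have "snd H \<subseteq> Pow (fst H)" using A by blast
  then have "finite (snd H)" using V by (meson finite_Pow_iff finite_subset)
  then show ?thesis
    unfolding SC_def
    using V A assms(2,3) by (intro secures_game_value) (auto intro: finite_subset)
qed

section \<open>Finite strategy trees that can be checked by evaluation\<close>

section \<open>Strategy certificates\<close>

(* Pairs: Maker answers each move in a pair by the other point of the pair.
   Reply: the pair (w, c) is the option to claim w and to continue with c. *)
datatype strategy = Pairs "(nat \<times> nat) list" | Reply "(nat \<times> strategy) list"

fun carrier :: "strategy \<Rightarrow> nat list" where
  "carrier (Pairs ps) = concat (map (\<lambda>(a, b). [a, b]) ps)"
| "carrier (Reply rs) = concat (map (\<lambda>(w, c). w # carrier c) rs)"

text \<open>Runs through all ways in which Maker can end up with one point of each pair, so a leaf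
  of the tree is tested on finitely many explicit sets.\<close>

fun forced :: "(nat set \<Rightarrow> bool) \<Rightarrow> (nat \<times> nat) list \<Rightarrow> nat list \<Rightarrow> bool" where
  "forced Q [] M \<longleftrightarrow> Q (set M)"
| "forced Q ((a, b) # ps) M \<longleftrightarrow> forced Q ps (a # M) \<and> forced Q ps (b # M)"

(* In the case Reply, no point may meet all options: whatever Breaker claims, one survives. *)
fun valid :: "(nat set \<Rightarrow> bool) \<Rightarrow> strategy \<Rightarrow> nat list \<Rightarrow> bool" where
  "valid Q (Pairs ps) M \<longleftrightarrow> distinct (carrier (Pairs ps)) \<and> forced Q ps M"
| "valid Q (Reply rs) M \<longleftrightarrow> rs \<noteq> [] \<and>
     list_all (\<lambda>(w, c). w \<notin> set (carrier c) \<and> valid Q c (w # M)) rs \<and>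
     list_all (\<lambda>v. list_ex (\<lambda>(w, c). v \<noteq> w \<and> v \<notin> set (carrier c)) rs) (carrier (Reply rs))"

text \<open>Picking from each pair a point that lies in \<open>X\<close> singles out one branch of
  \<open>forced\<close>; its final set is contained in \<open>X\<close>.\<close>

lemma forced_imp:
  assumes "mono Q" "forced Q ps M" "set M \<subseteq> X" "\<forall>(a, b)\<in>set ps. a \<in> X \<or> b \<in> X"
  shows "Q X"
  using assms(2-)
proof (induction ps arbitrary: M)
  case Nil
  then show ?case using monoD[OF assms(1), of "set M" X] by simp
qed auto

text \<open>The pairing strategy: each pair is a game of its own, and distinctness makes these games
  disjoint, so \<open>secures_conj\<close> combines them.\<close>

lemma secures_pairs:
  "distinct (carrier (Pairs ps)) \<Longrightarrow>
    secures (\<lambda>X. \<forall>(a, b)\<in>set ps. a \<in> X \<or> b \<in> X) (set (carrier (Pairs ps))) {}"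
proof (induction ps)
  case Nil
  then show ?case by (simp add: secures.won)
next
  case (Cons p ps)
  obtain a b where p: "p = (a, b)" by force
  have pair: "secures (\<lambda>X. a \<in> X \<or> b \<in> X) {a, b} {}"
  proof (rule secures.reply)
    fix v assume "v \<in> {a, b}"
    then show "\<exists>w T. w \<in> {a, b} \<and> w \<noteq> v \<and> T \<subseteq> {a, b} - {v, w} \<and>
        secures (\<lambda>X. a \<in> X \<or> b \<in> X) T (insert w {})"
      using Cons.prems p
      by (intro exI[of _ "if v = a then b else a"] exI[of _ "{}"]) (auto intro: secures.won)
  qed simp
  have "secures (\<lambda>X. (a \<in> X \<or> b \<in> X) \<and> (\<forall>(a, b)\<in>set ps. a \<in> X \<or> b \<in> X))
     ({a, b} \<union> set (carrier (Pairs ps))) ({} \<union> {})"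
    using Cons.prems p
    by (intro secures_conj[OF pair Cons.IH]) (auto simp: mono_def)
  then show ?case by (simp add: p insert_commute)
qed

text \<open>Soundness of certificates. Validity supplies an option untouched by Breaker's move; its
  first point is the answer and its carrier is all that is used afterwards.\<close>

lemma valid_secures:
  assumes "mono Q" "valid Q c M"
  shows "secures Q (set (carrier c)) (set M)"
  using assms(2)
proof (induction c arbitrary: M)
  case (Pairs ps)
  have "secures Q (set (carrier (Pairs ps))) ({} \<union> set M)"
    using Pairs forced_imp[OF assms(1), of ps M]
    by (intro secures_imp[OF secures_pairs]) (auto 4 4)
  then show ?case by simp
next
  case (Reply rs)
  show ?case
  proof (rule secures.reply)
    show "set (carrier (Reply rs)) \<noteq> {}" using Reply.prems by (cases rs) auto
    fix v assume "v \<in> set (carrier (Reply rs))"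
    then obtain w c where rs: "(w, c) \<in> set rs" "v \<noteq> w" "v \<notin> set (carrier c)"
      using Reply.prems by (auto simp del: carrier.simps simp: list_all_iff list_ex_iff)
    then have c: "w \<notin> set (carrier c)" "valid Q c (w # M)"
      using Reply.prems by (auto simp: list_all_iff)
    have "secures Q (set (carrier c)) (set (w # M))"
      using rs(1) by (intro Reply.IH[of "(w, c)" c] c) auto
    moreover have "insert w (set (carrier c)) \<subseteq> set (carrier (Reply rs))"
      using rs(1) by auto
    ultimately show "\<exists>w T. w \<in> set (carrier (Reply rs)) \<and> w \<noteq> v \<and>
        T \<subseteq> set (carrier (Reply rs)) - {v, w} \<and> secures Q T (insert w (set M))"
      using rs c(1) by (intro exI[of _ w] exI[of _ "set (carrier c)"]) auto
  qed
qed

section \<open>Maker secures two of the eight faces of a single block\<close>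

section \<open>The 3 x 5 block\<close>

(* The point in row r and column c of the block is encoded as 5 * r + c. *)
definition corners :: "nat \<Rightarrow> nat list" where
  "corners k = [k, k + 5, k + 1, k + 6]"

text \<open>The listed codes are the lower corners of the eight faces; points of the last row and
  last column are lower corners of none. Lists make the condition executable.\<close>

definition two_faces :: "nat set \<Rightarrow> bool" where
  "two_faces X \<longleftrightarrow>
     2 \<le> length (filter (\<lambda>k. 3 \<le> length (filter (\<lambda>p. p \<in> X) (corners k))) [0, 1, 2, 3, 5, 6, 7, 8])"

(* Found by computer search. *)
definition block_strategy :: strategy where
  "block_strategy = Reply
   [(8, Reply
      [(7, Pairs [(2, 3), (12, 13)]),
       (9, Pairs [(3, 4), (13, 14)]),
       (13, Pairs [(7, 12), (9, 14)]),
       (3, Pairs [(2, 7), (4, 9)])]),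
    (6, Reply
      [(7, Pairs [(2, 1), (12, 11)]),
       (5, Pairs [(1, 0), (11, 10)]),
       (11, Pairs [(7, 12), (5, 10)]),
       (1, Pairs [(2, 7), (0, 5)])]),
    (6, Reply
      [(11, Pairs [(5, 10), (7, 12)]),
       (5, Pairs [(0, 1), (10, 11)]),
       (7, Reply
         [(1, Pairs [(0, 12)]),
          (12, Pairs [(8, 13)]),
          (1, Pairs [(0, 8), (3, 13)])])]),
    (6, Reply
      [(1, Pairs [(5, 0), (7, 2)]),
       (5, Pairs [(10, 11), (0, 1)]),
       (7, Reply
         [(11, Pairs [(10, 2)]),
          (2, Pairs [(8, 3)]),
          (11, Pairs [(10, 8), (13, 3)])])]),
    (6, Reply
      [(5, Pairs [(0, 1), (10, 11)]),
       (1, Reply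
         [(5, Pairs [(10, 11)]),
          (5, Pairs [(2, 10)]),
          (5, Pairs [(2, 11)]),
          (2, Reply
            [(11, Pairs [(10, 12)]),
             (8, Pairs [(3, 9), (13, 14)])])]),
       (11, Reply
         [(5, Pairs [(0, 1)]),
          (5, Pairs [(1, 12)]),
          (5, Pairs [(0, 12)]),
          (12, Reply
            [(1, Pairs [(0, 2)]),
             (8, Pairs [(3, 4), (9, 13)])])]),
       (8, Reply
         [(9, Pairs [(3, 4), (13, 14)]),
          (2, Reply
            [(3, Pairs [(1, 4)]),
             (1, Pairs [(0, 11), (10, 12)]),
             (3, Pairs [(4, 11), (10, 12)])]),
          (12, Reply
            [(11, Pairs [(0, 2), (1, 10)]),
             (13, Pairs [(9, 14)])])]),
       (8, Reply
         [(9, Pairs [(3, 4), (13, 14)]),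
          (12, Reply
            [(13, Pairs [(11, 14)]),
             (11, Pairs [(5, 10)]),
             (13, Pairs [(0, 10), (5, 14)])]),
          (5, Reply
            [(11, Pairs [(0, 12)]),
             (3, Pairs [(2, 10), (4, 9)])])]),
       (1, Reply
         [(5, Pairs [(2, 10)]),
          (2, Reply
            [(0, Pairs []),
             (8, Pairs [(3, 9), (4, 13)])]),
          (8, Reply
            [(9, Pairs [(3, 4), (5, 14)]),
             (13, Pairs [(0, 5), (12, 14)]),
             (9, Pairs [(0, 13), (3, 4)])])])])]"

text \<open>The first two options at the root claim the centre of the 3 x 3 square on columns 2 to
  4, respectively 0 to 2, and stay inside it; they meet an opening in the two other columns. The
  last three avoid 2, 12 and 7 in turn and meet an opening in the middle column.\<close>

lemma valid_block_strategy: "valid two_faces block_strategy []"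
  by code_simp

lemma carrier_block_strategy: "set (carrier block_strategy) \<subseteq> {..<15}"
proof -
  have "list_all (\<lambda>p. p < 15) (carrier block_strategy)" by code_simp
  then show ?thesis by (auto simp: list_all_iff)
qed

lemma mono_two_faces: "mono two_faces"
proof (rule monoI, rule le_boolI)
  have filter_le: "length (filter P xs) \<le> length (filter P' xs)" if "\<And>x. P x \<Longrightarrow> P' x"
    for P P' :: "nat \<Rightarrow> bool" and xs
    using that by (induction xs) auto
  fix X Y :: "nat set" assume "X \<subseteq> Y" "two_faces X"
  then have "length (filter (\<lambda>p. p \<in> X) xs) \<le> length (filter (\<lambda>p. p \<in> Y) xs)" for xs
    by (intro filter_le) auto
  then have "length (filter (\<lambda>k. 3 \<le> length (filter (\<lambda>p. p \<in> X) (corners k))) ks) \<le>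
      length (filter (\<lambda>k. 3 \<le> length (filter (\<lambda>p. p \<in> Y) (corners k))) ks)" for ks
    by (intro filter_le) (meson order_trans)
  with \<open>two_faces X\<close> show "two_faces Y" unfolding two_faces_def by (meson order_trans)
qed

text \<open>As fibres of floor division the blocks partition the whole lattice, negative coordinates
  included.\<close>

definition block :: "int \<times> int \<Rightarrow> (int \<times> int) set" where
  "block t = {p. fst p div 3 = fst t \<and> snd p div 5 = snd t}"

definition block_point :: "int \<times> int \<Rightarrow> nat \<Rightarrow> int \<times> int" where
  "block_point t k = (3 * fst t + int (k div 5), 5 * snd t + int (k mod 5))"

lemma block_eq: "block t = {3 * fst t..<3 * fst t + 3} \<times> {5 * snd t..<5 * snd t + 5}"
  unfolding block_def by (auto simp: mem_Times_iff)

lemma card_block: "card (block t) = 15" and finite_block: "finite (block t)"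
  unfolding block_eq by (simp_all add: card_cartesian_product)

lemma disjoint_block: "s \<noteq> t \<Longrightarrow> block s \<inter> block t = {}"
  by (auto simp: block_def prod_eq_iff)

lemma inj_on_block_point: "inj_on (block_point t) {..<15}"
proof (rule inj_onI)
  fix k l assume "block_point t k = block_point t l"
  then have "k div 5 = l div 5" "k mod 5 = l mod 5" by (auto simp: block_point_def)
  then show "k = l" by (metis div_mult_mod_eq)
qed

lemma block_point_in_block: "k < 15 \<Longrightarrow> block_point t k \<in> block t"
  by (auto simp: block_eq block_point_def)

lemma image_block_point: "N \<subseteq> {..<15} \<Longrightarrow> block_point t ` N \<subseteq> block t"
  using block_point_in_block[of _ t] by (intro image_subsetI) blast

text \<open>The base point is the coordinatewise minimum of its square, so distinct base points
  count distinct faces.\<close>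

lemma unit_square_inj: "unit_square p = unit_square q \<longleftrightarrow> p = q"
proof
  assume eq: "unit_square p = unit_square q"
  have "p \<in> unit_square p" "q \<in> unit_square q" by (auto simp: unit_square_def split: prod.splits)
  then have "p \<in> unit_square q" "q \<in> unit_square p" using eq by simp_all
  then show "p = q" by (auto simp: unit_square_def split: prod.splits)
qed simp

lemma finite_unit_square: "finite (unit_square p)" and unit_square_nonempty: "unit_square p \<noteq> {}"
  by (auto simp: unit_square_def split: prod.splits)

text \<open>The restriction on \<open>k\<close> excludes the last column, where the code
  \<open>k + 1\<close> wraps around to the next row.\<close>

lemma image_corners:
  assumes "k \<in> set [0, 1, 2, 3, 5, 6, 7, 8]"
  shows "block_point t ` set (corners k) = unit_square (block_point t k)"
proof -
  have "k = 0 \<or> k = 1 \<or> k = 2 \<or> k = 3 \<or> k = 5 \<or> k = 6 \<or> k = 7 \<or> k = 8" using assms by simp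
  then show ?thesis
    by (elim disjE) (simp_all add: corners_def block_point_def unit_square_def add.commute)
qed

text \<open>The lists have no repetitions, and \<open>block_point t\<close> is injective on codes,
  so both list counts, of faces and of corners, become cardinalities.\<close>

lemma two_faces_block:
  assumes "two_faces X"
  shows "2 \<le> score (faces (block t)) 3 (block_point t ` X)"
proof -
  define P where "P k \<longleftrightarrow> 3 \<le> length (filter (\<lambda>p. p \<in> X) (corners k))" for k
  define ks :: "nat list" where "ks = [0, 1, 2, 3, 5, 6, 7, 8]"
  let ?K = "set (filter P ks)"
  let ?f = "\<lambda>k. unit_square (block_point t k)"
  have "distinct ks" by (simp add: ks_def)
  then have "card ?K = length (filter P ks)" by (intro distinct_card distinct_filter)
  then have "2 \<le> card ?K"
    using assms unfolding two_faces_def P_def ks_def by simp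
  also have "card ?K = card (?f ` ?K)"
  proof (rule card_image[symmetric])
    have "set ks \<subseteq> {..<15}" by (simp add: ks_def)
    then have "inj_on (block_point t) ?K"
      by (intro inj_on_subset[OF inj_on_block_point]) auto
    then show "inj_on ?f ?K" by (simp add: inj_on_def unit_square_inj)
  qed
  also have "\<dots> \<le> card {A \<in> faces (block t). 3 \<le> card (A \<inter> block_point t ` X)}"
  proof (rule card_mono)
    show "finite {A \<in> faces (block t). 3 \<le> card (A \<inter> block_point t ` X)}"
      using finite_faces[OF finite_block] by simp
    show "?f ` ?K \<subseteq> {A \<in> faces (block t). 3 \<le> card (A \<inter> block_point t ` X)}"
    proof (rule image_subsetI)
      fix k assume "k \<in> ?K"
      then have "k \<in> set ks" and k: "P k" by simp_all
      note corner = this(1)[unfolded ks_def]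
      let ?C = "set (corners k)"
      have lt: "?C \<subseteq> {..<15}" using corner by (auto simp: corners_def)
      have "?f k \<subseteq> block t"
        using image_corners[OF corner, of t] image_block_point[OF lt] by metis
      moreover have "3 \<le> card (?f k \<inter> block_point t ` X)"
      proof -
        have "distinct (corners k)" by (simp add: corners_def)
        then have "length (filter (\<lambda>p. p \<in> X) (corners k)) = card (?C \<inter> X)"
          using distinct_card[of "filter (\<lambda>p. p \<in> X) (corners k)"]
          by (simp add: Int_def del: distinct_card)
        also have "\<dots> = card (block_point t ` (?C \<inter> X))"
          using lt by (intro card_image[symmetric] inj_on_subset[OF inj_on_block_point]) auto
        also have "\<dots> \<le> card (?f k \<inter> block_point t ` X)"
          using image_corners[OF corner, of t] finite_unit_square by (intro card_mono) auto
        finally show ?thesis using k by (simp add: P_def)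
      qed
      ultimately show "?f k \<in> {A \<in> faces (block t). 3 \<le> card (A \<inter> block_point t ` X)}"
        by (simp add: faces_def)
    qed
  qed
  finally show ?thesis by (simp add: score_def)
qed

lemma secures_block: "secures (\<lambda>X. 2 \<le> score (faces (block t)) 3 X) (block t) {}"
proof -
  have "secures two_faces {..<15} {}"
    using valid_secures[OF mono_two_faces valid_block_strategy] carrier_block_strategy
    by (auto intro: secures_superset)
  from secures_image[where Q' = "\<lambda>X. 2 \<le> score (faces (block t)) 3 X",
      OF this inj_on_block_point two_faces_block]
  have "secures (\<lambda>X. 2 \<le> score (faces (block t)) 3 X) (block_point t ` {..<15}) {}" by simp
  then show ?thesis by (rule secures_superset) (rule image_block_point, simp)
qed

section \<open>Adding up over blocks and comparing their number with that of the faces\<close>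

section \<open>Counting blocks\<close>

text \<open>A face is nonempty and so lies inside at most one block; faces that straddle blocks are
  simply not counted on the left.\<close>

lemma score_blocks:
  assumes "finite V" "finite I" "\<And>t. t \<in> I \<Longrightarrow> block t \<subseteq> V"
  shows "(\<Sum>t\<in>I. score (faces (block t)) s X) \<le> score (faces V) s X"
proof -
  let ?G = "\<lambda>V. {A \<in> faces V. s \<le> card (A \<inter> X)}"
  have "(\<Sum>t\<in>I. card (?G (block t))) = card (\<Union>t\<in>I. ?G (block t))"
  proof (rule card_UN_disjoint[symmetric])
    show "\<forall>t\<in>I. finite (?G (block t))" using finite_faces[OF finite_block] by simp
    show "\<forall>t\<in>I. \<forall>u\<in>I. t \<noteq> u \<longrightarrow> ?G (block t) \<inter> ?G (block u) = {}"
    proof (intro ballI impI equals0I)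
      fix t u A assume "t \<noteq> u" and A: "A \<in> ?G (block t) \<inter> ?G (block u)"
      then have "A \<subseteq> block t \<inter> block u" "A \<noteq> {}"
        using unit_square_nonempty by (auto simp: faces_def)
      with disjoint_block[OF \<open>t \<noteq> u\<close>] show False by simp
    qed
  qed (rule assms)
  also have "\<dots> \<le> card (?G V)"
    using assms finite_faces[of V] by (intro card_mono) (auto simp: faces_def)
  finally show ?thesis by (simp add: score_def)
qed

lemma SC_ge_blocks:
  assumes "finite V" "finite I" "\<And>t. t \<in> I \<Longrightarrow> block t \<subseteq> V"
  shows "2 * card I \<le> SC (square_grid V) 3"
proof (rule secures_SC)
  show "uniform_hypergraph 4 (square_grid V)" by (rule uniform_square_grid[OF assms(1)])
  show "(\<Union>t\<in>I. block t) \<subseteq> fst (square_grid V)" using assms(3) by (auto simp: square_grid_def)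
  have all: "secures (\<lambda>X. \<forall>t\<in>I. 2 \<le> score (faces (block t)) 3 X) (\<Union>t\<in>I. block t) {}"
  proof (rule secures_UN[OF assms(2) _ secures_block])
    show "disjoint_family_on block I" using disjoint_block by (auto simp: disjoint_family_on_def)
    show "mono (\<lambda>X. 2 \<le> score (faces (block t)) 3 X)" for t
      by (rule mono_score[OF finite_faces[OF finite_block]])
        (auto simp: faces_def finite_unit_square)
  qed
  have "secures (\<lambda>X. 2 * card I \<le> score (faces V) 3 X) (\<Union>t\<in>I. block t) ({} \<union> {})"
  proof (rule secures_imp[OF all])
    fix X assume "\<forall>t\<in>I. 2 \<le> score (faces (block t)) 3 X"
    then have "(\<Sum>t\<in>I. 2) \<le> (\<Sum>t\<in>I. score (faces (block t)) 3 X)" by (intro sum_mono) simp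
    also have "\<dots> \<le> score (faces V) 3 X" by (rule score_blocks[OF assms])
    finally show "2 * card I \<le> score (faces V) 3 (X \<union> {})" by (simp add: mult.commute)
  qed
  then show "secures (\<lambda>X. 2 * card I \<le> score (snd (square_grid V)) 3 X) (\<Union>t\<in>I. block t) {}"
    by (simp add: square_grid_def)
qed

(* Walk from c towards p by king's moves, whose endpoints share a unit square. *)
lemma boundary_point_between:
  assumes "c \<in> V" "p \<notin> V"
  shows "\<exists>q\<in>grid_boundary V. \<bar>fst q - fst c\<bar> \<le> \<bar>fst p - fst c\<bar> \<and> \<bar>snd q - snd c\<bar> \<le> \<bar>snd p - snd c\<bar>"
  using assms(1)
proof (induction "nat (\<bar>fst p - fst c\<bar> + \<bar>snd p - snd c\<bar>)" arbitrary: c rule: less_induct)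
  case less
  define c' where "c' = (fst c + sgn (fst p - fst c), snd c + sgn (snd p - snd c))"
  \<comment> \<open>A king's move never overshoots \<open>p\<close>, so in each coordinate the
    distances add up exactly.\<close>
  have x: "\<bar>fst p - fst c\<bar> = \<bar>fst p - fst c'\<bar> + \<bar>fst c' - fst c\<bar>"
    and y: "\<bar>snd p - snd c\<bar> = \<bar>snd p - snd c'\<bar> + \<bar>snd c' - snd c\<bar>"
    by (auto simp: c'_def sgn_if)
  show ?case
  proof (cases "c' \<in> V")
    case True
    have "c \<noteq> p" using less(2) assms(2) by blast
    then have "c' \<noteq> c" by (auto simp: c'_def prod_eq_iff sgn_if split: if_splits)
    then have "\<bar>fst c' - fst c\<bar> + \<bar>snd c' - snd c\<bar> > 0"
      by (auto simp: prod_eq_iff)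
    then have "nat (\<bar>fst p - fst c'\<bar> + \<bar>snd p - snd c'\<bar>) < nat (\<bar>fst p - fst c\<bar> + \<bar>snd p - snd c\<bar>)"
      unfolding x y by simp
    from less(1)[OF this True] obtain q where q: "q \<in> grid_boundary V"
      "\<bar>fst q - fst c'\<bar> \<le> \<bar>fst p - fst c'\<bar>" "\<bar>snd q - snd c'\<bar> \<le> \<bar>snd p - snd c'\<bar>" by blast
    have "\<bar>fst q - fst c\<bar> \<le> \<bar>fst p - fst c\<bar>" using q(2) x by linarith
    moreover have "\<bar>snd q - snd c\<bar> \<le> \<bar>snd p - snd c\<bar>" using q(3) y by linarith
    ultimately show ?thesis using q(1) by blast
  next
    case False
    \<comment> \<open>\<open>d\<close> is the base point of a unit square through both
      \<open>c\<close> and \<open>c'\<close>; as \<open>c'\<close> is missing from \<open>V\<close>,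
      this square makes \<open>c\<close> a boundary point.\<close>
    define d where "d = (min (fst c) (fst c'), min (snd c) (snd c'))"
    have "c \<in> unit_square d" "c' \<in> unit_square d"
      by (cases c; auto simp: d_def c'_def unit_square_def sgn_if)+
    then have "c \<in> grid_boundary V" using False less(2) unfolding grid_boundary_def by blast
    then show ?thesis by (intro bexI[of _ c]) auto
  qed
qed

lemma lattice_dist_le: "lattice_dist p q \<le> real_of_int (\<bar>fst p - fst q\<bar> + \<bar>snd p - snd q\<bar>)"
  unfolding lattice_dist_def dist_Pair_Pair
  using sqrt_sum_squares_le_sum_abs[of "real_of_int (fst p) - real_of_int (fst q)"
      "real_of_int (snd p) - real_of_int (snd q)"]
  by (simp add: dist_real_def)

text \<open>Each face is charged to the block of its lower corner, or else lies near the
  boundary.\<close>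

lemma faces_le_blocks:
  assumes "finite V"
  defines "I \<equiv> {t. block t \<subseteq> V}"
  shows "finite I" "card (faces V) \<le> 15 * card I + card (faces_near_boundary 6 V)"
proof -
  \<comment> \<open>Every block inside \<open>V\<close> contributes its own corner point to the
    finite set \<open>V\<close>.\<close>
  have "(\<lambda>t. block_point t 0) ` I \<subseteq> V" using block_point_in_block by (auto simp: I_def)
  moreover have "inj_on (\<lambda>t. block_point t 0) I"
    by (auto simp: inj_on_def block_point_def prod_eq_iff)
  ultimately show I: "finite I" using assms(1) by (meson finite_subset finite_imageD)
  \<comment> \<open>\<open>?B\<close> also contains squares that stick out of their block or of
    \<open>V\<close>, which is harmless for an upper bound.\<close>
  let ?B = "\<Union>t\<in>I. unit_square ` block t"
  have "faces V \<subseteq> ?B \<union> faces_near_boundary 6 V"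
  proof
    fix A assume A: "A \<in> faces V"
    then obtain c where c: "A = unit_square c" by (auto simp: faces_def)
    have cA: "c \<in> A" by (auto simp: c unit_square_def split: prod.splits)
    then have cV: "c \<in> V" using A by (auto simp: faces_def)
    define t where "t = (fst c div 3, snd c div 5)"
    have ct: "c \<in> block t" by (simp add: block_def t_def)
    show "A \<in> ?B \<union> faces_near_boundary 6 V"
    proof (cases "t \<in> I")
      case True
      then show ?thesis using ct c by blast
    next
      case False
      then obtain p where p: "p \<in> block t" "p \<notin> V" by (auto simp: I_def)
      from boundary_point_between[OF cV p(2)] obtain q where q: "q \<in> grid_boundary V"
        "\<bar>fst q - fst c\<bar> \<le> \<bar>fst p - fst c\<bar>" "\<bar>snd q - snd c\<bar> \<le> \<bar>snd p - snd c\<bar>" by blast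
      \<comment> \<open>Two points of a 3 x 5 block differ by at most 2 and 4 in the coordinates,
        whence the distance 6 = 2 + 4.\<close>
      have "\<bar>fst p - fst c\<bar> \<le> 2" "\<bar>snd p - snd c\<bar> \<le> 4"
        using p(1) ct by (auto simp: block_eq mem_Times_iff)
      then have "\<bar>fst c - fst q\<bar> + \<bar>snd c - snd q\<bar> \<le> 6" using q(2,3) by linarith
      then have "lattice_dist c q \<le> 6" using lattice_dist_le[of c q] by linarith
      then show ?thesis using A cA q(1) by (auto simp: faces_near_boundary_def)
    qed
  qed
  moreover have "finite ?B" using I finite_block by simp
  moreover have "finite (faces_near_boundary 6 V)"
    using finite_faces[OF assms(1)] by (simp add: faces_near_boundary_def)
  ultimately have "card (faces V) \<le> card (?B \<union> faces_near_boundary 6 V)"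
    by (intro card_mono) simp_all
  then have "card (faces V) \<le> card ?B + card (faces_near_boundary 6 V)"
    by (rule order_trans[OF _ card_Un_le])
  moreover have "card ?B \<le> (\<Sum>t\<in>I. 15)"
  proof (rule order_trans[OF card_UN_le[OF I]], rule sum_mono)
    show "card (unit_square ` block t) \<le> 15" for t
      using card_image_le[OF finite_block, of unit_square t] by (simp add: card_block)
  qed
  ultimately show "card (faces V) \<le> 15 * card I + card (faces_near_boundary 6 V)"
    by (simp add: mult.commute)
qed

theorem theorem13:
  fixes \<C> :: "(int \<times> int) set set"
  assumes "\<And>V. V \<in> \<C> \<Longrightarrow> finite V"
    and "two_dimensional \<C>"
  shows "\<exists>e :: nat \<Rightarrow> real. e \<in> o(\<lambda>n. real n) \<and>
           (\<forall>V \<in> \<C>. real (SC (square_grid V) 3)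
              \<ge> 2 * real (card (faces V)) / 15 - e (card (faces V)))"
proof -
  from assms(2) obtain g where g: "g \<in> o(\<lambda>n. real n)"
    and near: "\<And>V. V \<in> \<C> \<Longrightarrow> real (card (faces_near_boundary 6 V)) \<le> g (card (faces V))"
    unfolding two_dimensional_def by blast
  show ?thesis
  \<comment> \<open>The error term comes from multiplying the bound of n by 15 times the number of
    blocks plus \<open>g n\<close> by 2/15.\<close>
  proof (intro exI[of _ "\<lambda>n. 2 / 15 * g n"] conjI ballI)
    show "(\<lambda>n. 2 / 15 * g n) \<in> o(\<lambda>n. real n)" using g by simp
    fix V assume V: "V \<in> \<C>"
    define I where "I = {t. block t \<subseteq> V}"
    note I = faces_le_blocks[OF assms(1)[OF V], folded I_def]
    have "real (card (faces V)) \<le> 15 * real (card I) + g (card (faces V))"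
      using I(2) near[OF V] by linarith
    moreover have "2 * card I \<le> SC (square_grid V) 3"
      by (rule SC_ge_blocks[OF assms(1)[OF V] I(1)]) (simp add: I_def)
    then have "2 * real (card I) \<le> real (SC (square_grid V) 3)" by linarith
    ultimately show "real (SC (square_grid V) 3)
        \<ge> 2 * real (card (faces V)) / 15 - 2 / 15 * g (card (faces V))"
      by (simp add: field_simps)
  qed
qed

end
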